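(* Let $g\in C^1((0,+\infty))$ be a strictly increasing real-valued function with $\lim_{s\to 0}g(s)=-\infty$ and $\lim_{s\to+\infty}g(s)<\infty$, and let $$W_g(t)=\frac{1}{2N^2}\sum_{i=1}^N\sum_{j=i+1}^N g(\|x_i(t)-x_j(t)\|^2)$$ be the associated generalized entropy functional along the trajectory $t\mapsto x(t)=(x_1(t),\dots,x_N(t))\in(\mathbb{R}^d)^N$ of the system. The following two statements are equivalent: (1) There exists $\eta>0$ such that for all $t>0$, $W_g(t)>\eta$. (2) There exists $\varepsilon>0$ such that for all $t>0$ and all $(i,j)\in\{1,\dots,N\}^2$ with $i\neq j$, $\|x_i(t)-x_j(t)\|>\varepsilon$. If the conditions above are satisfied, the system is declustered at all times.
   Context: $\|\cdot\|$ is the Euclidean norm on $\mathbb{R}^d$. The system is the controlled Hegselmann-Krause system $\dot x_i=\frac1N\sum_{j\neq i}a(\|x_i-x_j\|)(x_j-x_i)+u_i$, $i\in\{1,\dots,N\}$, with interaction function $a:\mathbb{R}^+\to\mathbb{R}^+$ and measurable control $u:\mathbb{R}^+\to(\mathbb{R}^d)^N$ satisfying $\sum_{i=1}^N\|u_i(t)\|\leq M$ for a.e. $t$, where $M>0$ is given. The system is (fully) declustered if there exists $\epsilon>0$ such that $\|x_i-x_j\|\geq\epsilon$ for all $i\neq j$.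
   Formalization: In (1), η is allowed to be any real number instead of η > 0, since with η > 0 the implication (2)⇒(1) fails (e.g. g(s) = −1/s makes W_g negative); g(0) is read as −∞ when two agents coincide. *)

theory Defs
  imports "HOL-Analysis.Analysis"
begin

definition abs_continuous_on_interval ::
    "real \<Rightarrow> real \<Rightarrow> (real \<Rightarrow> 'a::real_normed_vector) \<Rightarrow> bool"
  where "abs_continuous_on_interval S T f \<longleftrightarrow>
    (\<forall>\<epsilon>>0. \<exists>\<delta>>0. \<forall>(n::nat) (\<alpha>::nat \<Rightarrow> real) (\<beta>::nat \<Rightarrow> real).
      (\<forall>k<n. S \<le> \<alpha> k \<and> \<alpha> k \<le> \<beta> k \<and> \<beta> k \<le> T) \<and>
      (\<forall>k<n. \<forall>l<n. k \<noteq> l \<longrightarrow> {\<alpha> k<..<\<beta> k} \<inter> {\<alpha> l<..<\<beta> l} = {}) \<and>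
      (\<Sum>k<n. \<beta> k - \<alpha> k) < \<delta>
      \<longrightarrow> (\<Sum>k<n. norm (f (\<beta> k) - f (\<alpha> k))) < \<epsilon>)"

text \<open>Agents are indexed by \<open>{1..N}\<close>; the values of \<open>u t i\<close> and \<open>x t i\<close> at other
  indices, or at times \<open>t < 0\<close>, are irrelevant.\<close>

definition admissible_control ::
    "nat \<Rightarrow> real \<Rightarrow> (real \<Rightarrow> nat \<Rightarrow> real ^ 'd) \<Rightarrow> bool"
  where "admissible_control N M u \<longleftrightarrow>
    (\<forall>i\<in>{1..N}. (\<lambda>t. u t i) \<in> borel_measurable (lebesgue_on {0..})) \<and>
    (AE t in lebesgue_on {0..}. (\<Sum>i=1..N. norm (u t i)) \<le> M)"

text \<open>The control is merely measurable, so a trajectory is a solution in the sense of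
  Caratheodory: locally absolutely continuous, with the equation holding almost everywhere.\<close>

definition HK_trajectory ::
    "nat \<Rightarrow> (real \<Rightarrow> real) \<Rightarrow> (real \<Rightarrow> nat \<Rightarrow> real ^ 'd) \<Rightarrow> (real \<Rightarrow> nat \<Rightarrow> real ^ 'd) \<Rightarrow> bool"
  where "HK_trajectory N a u x \<longleftrightarrow>
    (\<forall>i\<in>{1..N}. \<forall>T>0. abs_continuous_on_interval 0 T (\<lambda>t. x t i)) \<and>
    (AE t in lebesgue_on {0..}. \<forall>i\<in>{1..N}.
      ((\<lambda>s. x s i) has_vector_derivative
        ((1 / real N) *\<^sub>R (\<Sum>j\<in>{1..N} - {i}. a (norm (x t i - x t j)) *\<^sub>R (x t j - x t i))
          + u t i)) (at t within {0..}))"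

text \<open>Since \<open>g\<close> tends to \<open>-\<infinity>\<close> at \<open>0\<close>, it is extended by \<open>g 0 = -\<infinity>\<close>; the entropy is
  therefore \<open>-\<infinity>\<close> for a configuration in which two agents coincide.\<close>

definition extend_at_zero :: "(real \<Rightarrow> real) \<Rightarrow> real \<Rightarrow> ereal"
  where "extend_at_zero g s = (if s = 0 then -\<infinity> else ereal (g s))"

definition gen_entropy :: "nat \<Rightarrow> (real \<Rightarrow> real) \<Rightarrow> (nat \<Rightarrow> real ^ 'd) \<Rightarrow> ereal"
  where "gen_entropy N g y =
    ereal (1 / (2 * real N ^ 2)) *
      (\<Sum>i=1..N. \<Sum>j=i+1..N. extend_at_zero g (norm (y i - y j) ^ 2))"

definition declustered_on :: "nat \<Rightarrow> real set \<Rightarrow> (real \<Rightarrow> nat \<Rightarrow> real ^ 'd) \<Rightarrow> bool"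
  where "declustered_on N I x \<longleftrightarrow>
    (\<exists>\<epsilon>>0. \<forall>t\<in>I. \<forall>i\<in>{1..N}. \<forall>j\<in>{1..N}. i \<noteq> j \<longrightarrow> norm (x t i - x t j) \<ge> \<epsilon>)"

end

theory Submission
  imports Defs
begin

text \<open>As \<open>g\<close> is bounded above by its limit at infinity, a lower bound on the entropy bounds every
  single summand \<open>g (\<parallel>x\<^sub>i - x\<^sub>j\<parallel>\<^sup>2)\<close> from below, and \<open>g \<rightarrow> -\<infinity>\<close> at \<open>0\<close> then keeps the distances away
  from \<open>0\<close>; the converse is monotonicity of \<open>g\<close>. The bound extends to \<open>t = 0\<close> since trajectories
  are continuous.\<close>

text \<open>The other \<open>card A - 1\<close> summands contribute at most \<open>K\<close> each,
  and this total is real, so it can be moved to the other side even in \<open>ereal\<close>. In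
  particular, \<open>f p\<close> cannot be -\<infinity>.\<close>

lemma sum_ereal_gt_imp_summand_gt:
  fixes f :: "'b \<Rightarrow> ereal" and K c :: real
  assumes "finite A" and le: "\<And>p. p \<in> A \<Longrightarrow> f p \<le> ereal K"
    and gt: "sum f A > ereal c" and p: "p \<in> A"
  shows "f p > ereal (c - real (card A - 1) * K)"
proof -
  have "sum f (A - {p}) \<le> (\<Sum>q\<in>A - {p}. ereal K)"
    by (intro sum_mono le) auto
  also have "\<dots> = ereal (real (card A - 1) * K)"
    using assms by simp
  finally have "f p + sum f (A - {p}) \<le> f p + ereal (real (card A - 1) * K)"
    by (rule add_left_mono)
  moreover have "sum f A = f p + sum f (A - {p})"
    using assms by (simp add: sum.remove)
  ultimately have "ereal c < f p + ereal (real (card A - 1) * K)"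
    using gt by simp
  then show ?thesis
    by (cases "f p") auto
qed

lemma strict_mono_on_less_tendsto_at_top:
  fixes g :: "real \<Rightarrow> real"
  assumes mono: "strict_mono_on {c<..} g" and lim: "(g \<longlongrightarrow> L) at_top" and "s > c"
  shows "g s < L"
proof -
  \<comment> \<open>Passing to the limit only preserves \<le>; the detour through
    \<open>s + 1\<close> recovers strictness.\<close>
  have "\<forall>\<^sub>F r in at_top. g (s + 1) \<le> g r"
    using eventually_gt_at_top[of "s + 1"]
  proof eventually_elim
    case (elim r)
    then show ?case
      using strict_mono_onD[OF mono, of "s + 1" r] \<open>s > c\<close> by simp
  qed
  then have "g (s + 1) \<le> L"
    by (intro tendsto_lowerbound[OF lim]) auto
  moreover have "g s < g (s + 1)"
    using \<open>s > c\<close> by (intro strict_mono_onD[OF mono]) auto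
  ultimately show ?thesis by simp
qed

lemma abs_continuous_on_interval_imp_continuous_on:
  assumes "abs_continuous_on_interval S T f"
  shows "continuous_on {S..T} f"
  unfolding continuous_on_iff
proof (intro ballI allI impI)
  fix s e :: real assume s: "s \<in> {S..T}" and "e > 0"
  from assms[unfolded abs_continuous_on_interval_def, rule_format, OF \<open>e > 0\<close>]
  obtain d where "d > 0" and d: "\<forall>n \<alpha> \<beta>.
      (\<forall>k<n. S \<le> \<alpha> k \<and> \<alpha> k \<le> \<beta> k \<and> \<beta> k \<le> T) \<and>
      (\<forall>k<n. \<forall>l<n. k \<noteq> l \<longrightarrow> {\<alpha> k<..<\<beta> k} \<inter> {\<alpha> l<..<\<beta> l} = {}) \<and>
      (\<Sum>k<n. \<beta> k - \<alpha> k) < d \<longrightarrow> (\<Sum>k<n::nat. norm (f (\<beta> k) - f (\<alpha> k))) < e"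
    by (elim exE conjE) (rule that)
  have "dist (f t) (f s) < e" if t: "t \<in> {S..T}" and "dist t s < d" for t
  proof -
    \<comment> \<open>A family consisting of one interval suffices; \<open>min\<close> and
      \<open>max\<close> put its endpoints in order.\<close>
    have "norm (f (max s t) - f (min s t)) < e"
      using d[rule_format, of 1 "\<lambda>_. min s t" "\<lambda>_. max s t"] s that
      by (auto simp: dist_real_def max_def min_def split: if_splits)
    then show ?thesis
      by (auto simp: dist_norm max_def min_def norm_minus_commute split: if_splits)
  qed
  then show "\<exists>d>0. \<forall>t\<in>{S..T}. dist t s < d \<longrightarrow> dist (f t) (f s) < e"
    using \<open>d > 0\<close> by blast
qed

text \<open>Flattens the double sum of the entropy to one index set, so that a single pair can be
  split off; each unordered pair occurs once.\<close>

definition agent_pairs :: "nat \<Rightarrow> (nat \<times> nat) set"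
  where "agent_pairs N = Sigma {1..N} (\<lambda>i. {i+1..N})"

definition pair_sum :: "nat \<Rightarrow> (real \<Rightarrow> real) \<Rightarrow> (nat \<Rightarrow> real ^ 'd) \<Rightarrow> ereal"
  where "pair_sum N g y = (\<Sum>p\<in>agent_pairs N. extend_at_zero g (norm (y (fst p) - y (snd p)) ^ 2))"

lemma finite_agent_pairs [simp]: "finite (agent_pairs N)"
  by (simp add: agent_pairs_def)

lemma gen_entropy_eq_pair_sum:
  "gen_entropy N g y = ereal (1 / (2 * real N ^ 2)) * pair_sum N g y"
  by (simp add: gen_entropy_def pair_sum_def agent_pairs_def sum.Sigma split_beta)

text \<open>The factor is positive and finite because \<open>N \<ge> 1\<close>, so it can be cleared
  even when two agents coincide and the sum is -\<infinity>.\<close>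

lemma gen_entropy_gt_iff:
  assumes "N \<ge> 1"
  shows "gen_entropy N g y > ereal \<eta> \<longleftrightarrow> pair_sum N g y > ereal (2 * real N ^ 2 * \<eta>)"
  using assms unfolding gen_entropy_eq_pair_sum
  by (cases "pair_sum N g y") (auto simp: field_simps)

text \<open>Stated for single configurations, with \<epsilon> chosen before \<open>y\<close>: along
  a trajectory the same \<epsilon> then serves all times.\<close>

lemma norm_diff_gt_if_gen_entropy_gt:
  fixes g :: "real \<Rightarrow> real"
  assumes "N \<ge> 1" and mono: "strict_mono_on {0<..} g"
    and bot: "filterlim g at_bot (at_right 0)" and lim: "(g \<longlongrightarrow> L) at_top"
  obtains \<epsilon> where "\<epsilon> > 0"
    and "\<And>(y :: nat \<Rightarrow> real ^ 'd) i j. \<lbrakk>gen_entropy N g y > ereal \<eta>; i \<in> {1..N}; j \<in> {1..N}; i \<noteq> j\<rbrakk>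
           \<Longrightarrow> norm (y i - y j) > \<epsilon>"
proof -
  \<comment> \<open>The lower bound for one summand when the sum over pairs exceeds
    \<open>2 * real N ^ 2 * \<eta>\<close> and every other summand is at most
    \<open>L\<close>.\<close>
  define B where "B = 2 * real N ^ 2 * \<eta> - real (card (agent_pairs N) - 1) * L"
  have "\<forall>\<^sub>F s in at_right 0. g s \<le> B"
    using bot by (simp add: filterlim_at_bot)
  then obtain \<delta> where "\<delta> > 0" and \<delta>: "\<And>s. 0 < s \<Longrightarrow> s < \<delta> \<Longrightarrow> g s \<le> B"
    unfolding eventually_at_right_field by auto
  \<comment> \<open>The squared distance will only be shown to be \<ge> \<delta>; halving the root
    makes the final bound strict.\<close>
  define \<epsilon> where "\<epsilon> = sqrt \<delta> / 2"
  have "\<epsilon> > 0" using \<open>\<delta> > 0\<close> by (simp add: \<epsilon>_def)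
  have "\<epsilon> ^ 2 < \<delta>" using \<open>\<delta> > 0\<close> by (simp add: \<epsilon>_def power_divide)
  have ordered: "norm (y i - y j) > \<epsilon>"
    if y: "gen_entropy N g y > ereal \<eta>" and p: "(i, j) \<in> agent_pairs N"
    for y :: "nat \<Rightarrow> real ^ 'd" and i j
  proof -
    have "extend_at_zero g s \<le> ereal L" if "s \<ge> 0" for s
      using strict_mono_on_less_tendsto_at_top[OF mono lim, of s] that
      by (auto simp: extend_at_zero_def less_imp_le)
    then have "extend_at_zero g (norm (y i - y j) ^ 2) > ereal B"
      using sum_ereal_gt_imp_summand_gt[OF finite_agent_pairs _ _ p, of
          "\<lambda>p. extend_at_zero g (norm (y (fst p) - y (snd p)) ^ 2)" L "2 * real N ^ 2 * \<eta>"]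
        y[unfolded gen_entropy_gt_iff[OF \<open>N \<ge> 1\<close>]]
      by (simp add: pair_sum_def B_def)
    \<comment> \<open>Since \<open>B\<close> is real, the value -\<infinity> taken at coinciding
      agents is excluded.\<close>
    then have "y i \<noteq> y j" and "g (norm (y i - y j) ^ 2) > B"
      by (auto simp: extend_at_zero_def split: if_splits)
    then have "norm (y i - y j) ^ 2 \<ge> \<delta>"
      using \<delta>[of "norm (y i - y j) ^ 2"] by fastforce
    then show ?thesis
      using \<open>\<epsilon> ^ 2 < \<delta>\<close> by (intro power2_less_imp_less[of \<epsilon>]) auto
  qed
  have "norm (y i - y j) > \<epsilon>"
    if "gen_entropy N g y > ereal \<eta>" "i \<in> {1..N}" "j \<in> {1..N}" "i \<noteq> j"
    for y :: "nat \<Rightarrow> real ^ 'd" and i j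
  proof (cases "i < j")
    case True
    then show ?thesis using ordered[of y i j] that by (simp add: agent_pairs_def)
  next
    case False
    then show ?thesis
      using ordered[of y j i] that by (simp add: agent_pairs_def norm_minus_commute)
  qed
  then show thesis using that \<open>\<epsilon> > 0\<close> by blast
qed

text \<open>Monotonicity bounds each summand below by \<open>g (\<epsilon> ^ 2)\<close>, whatever
  the configuration, so \<eta> is again uniform in time.\<close>

lemma gen_entropy_gt_if_norm_diff_gt:
  fixes g :: "real \<Rightarrow> real"
  assumes "N \<ge> 1" and mono: "strict_mono_on {0<..} g" and "\<epsilon> > 0"
  obtains \<eta> :: real where "\<And>y :: nat \<Rightarrow> real ^ 'd.
    (\<And>i j. \<lbrakk>i \<in> {1..N}; j \<in> {1..N}; i \<noteq> j\<rbrakk> \<Longrightarrow> norm (y i - y j) > \<epsilon>)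
      \<Longrightarrow> gen_entropy N g y > ereal \<eta>"
proof -
  define c where "c = real (card (agent_pairs N)) * g (\<epsilon> ^ 2)"
  \<comment> \<open>Subtracting 1 yields a strict inequality also for \<open>N = 1\<close>, where
    there are no pairs and the sum equals \<open>c = 0\<close>.\<close>
  have "gen_entropy N g y > ereal ((c - 1) / (2 * real N ^ 2))"
    if y: "\<And>i j. \<lbrakk>i \<in> {1..N}; j \<in> {1..N}; i \<noteq> j\<rbrakk> \<Longrightarrow> norm (y i - y j) > \<epsilon>"
    for y :: "nat \<Rightarrow> real ^ 'd"
  proof -
    have "ereal (g (\<epsilon> ^ 2)) \<le> extend_at_zero g (norm (y (fst p) - y (snd p)) ^ 2)"
      if "p \<in> agent_pairs N" for p
    proof -
      have "norm (y (fst p) - y (snd p)) > \<epsilon>"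
        using that by (intro y) (auto simp: agent_pairs_def)
      then have "\<epsilon> ^ 2 < norm (y (fst p) - y (snd p)) ^ 2"
        using \<open>\<epsilon> > 0\<close> by (intro power_strict_mono) auto
      moreover have "\<epsilon> ^ 2 > 0" using \<open>\<epsilon> > 0\<close> by simp
      ultimately have "g (\<epsilon> ^ 2) < g (norm (y (fst p) - y (snd p)) ^ 2)"
        by (intro strict_mono_onD[OF mono]) (auto simp del: zero_less_power2)
      then show ?thesis
        using \<open>\<epsilon> ^ 2 < _\<close> \<open>\<epsilon> ^ 2 > 0\<close> by (auto simp: extend_at_zero_def)
    qed
    then have "(\<Sum>p\<in>agent_pairs N. ereal (g (\<epsilon> ^ 2))) \<le> pair_sum N g y"
      unfolding pair_sum_def by (rule sum_mono)
    then have "ereal c \<le> pair_sum N g y"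
      by (simp add: c_def)
    moreover have "ereal (c - 1) < ereal c" by simp
    ultimately have "ereal (c - 1) < pair_sum N g y"
      by (rule less_le_trans[rotated])
    then show ?thesis
      using \<open>N \<ge> 1\<close> by (simp add: gen_entropy_gt_iff)
  qed
  then show thesis by (rule that)
qed

text \<open>At time 0 the bound is the right-hand limit of the bounds at positive times. It survives
  there as \<ge> with the same \<epsilon>, which is what \<open>declustered_on\<close> asks
  for.\<close>

lemma declustered_on_atLeast_0:
  assumes traj: "HK_trajectory N a u x" and "\<epsilon> > 0"
    and gt: "\<And>t i j. \<lbrakk>t > 0; i \<in> {1..N}; j \<in> {1..N}; i \<noteq> j\<rbrakk> \<Longrightarrow> norm (x t i - x t j) > \<epsilon>"
  shows "declustered_on N {0..} x"
proof -
  have "norm (x t i - x t j) \<ge> \<epsilon>"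
    if "t \<ge> 0" and i: "i \<in> {1..N}" and j: "j \<in> {1..N}" and "i \<noteq> j" for t i j
  proof (cases "t = 0")
    case True
    have cont: "continuous_on {0..1} (\<lambda>t. x t k)" if "k \<in> {1..N}" for k
      using traj that
      by (intro abs_continuous_on_interval_imp_continuous_on) (auto simp: HK_trajectory_def)
    have "((\<lambda>t. norm (x t i - x t j)) \<longlongrightarrow> norm (x 0 i - x 0 j)) (at 0 within {0..1})"
      using continuous_on_norm[OF continuous_on_diff[OF cont[OF i] cont[OF j]]]
      by (simp add: continuous_on_def)
    then have "((\<lambda>t. norm (x t i - x t j)) \<longlongrightarrow> norm (x 0 i - x 0 j)) (at_right 0)"
      by (simp add: at_within_Icc_at_right)
    moreover have "\<forall>\<^sub>F t in at_right 0. \<epsilon> \<le> norm (x t i - x t j)"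
      using eventually_at_right_less[of 0]
      by eventually_elim (use gt i j \<open>i \<noteq> j\<close> in \<open>auto intro: less_imp_le\<close>)
    ultimately show ?thesis
      using True by (auto intro: tendsto_lowerbound)
  next
    case False
    then show ?thesis using gt[of t i j] that by simp
  qed
  then show ?thesis
    using \<open>\<epsilon> > 0\<close> unfolding declustered_on_def by auto
qed

text \<open>The bound \<eta> ranges over all reals: if the limit of \<open>g\<close> at infinity is
  at most 0, the entropy is never positive, however well separated the agents are.\<close>

theorem theorem1p1:
  fixes N :: nat
    and M :: real
    and a :: "real \<Rightarrow> real"
    and u x :: "real \<Rightarrow> nat \<Rightarrow> real ^ 'd"
    and g :: "real \<Rightarrow> real"
  assumes "N \<ge> 1"
    and "M > 0"
    and "\<And>r. r \<ge> 0 \<Longrightarrow> a r \<ge> 0"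
    and "admissible_control N M u"
    and "HK_trajectory N a u x"
    and "g C1_differentiable_on {0<..}"
    and "strict_mono_on {0<..} g"
    and "filterlim g at_bot (at_right 0)"
    and "\<exists>L. (g \<longlongrightarrow> L) at_top"
  shows "((\<exists>\<eta>::real. \<forall>t>0. gen_entropy N g (x t) > ereal \<eta>) \<longleftrightarrow>
          (\<exists>\<epsilon>>0. \<forall>t>0. \<forall>i\<in>{1..N}. \<forall>j\<in>{1..N}. i \<noteq> j \<longrightarrow> norm (x t i - x t j) > \<epsilon>))
       \<and> ((\<exists>\<eta>::real. \<forall>t>0. gen_entropy N g (x t) > ereal \<eta>) \<longrightarrow> declustered_on N {0..} x)"
proof -
  obtain L where L: "(g \<longlongrightarrow> L) at_top" using assms by blast
  let ?low = "\<exists>\<eta>::real. \<forall>t>0. gen_entropy N g (x t) > ereal \<eta>"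
  let ?sep = "\<exists>\<epsilon>>0. \<forall>t>0. \<forall>i\<in>{1..N}. \<forall>j\<in>{1..N}. i \<noteq> j \<longrightarrow> norm (x t i - x t j) > \<epsilon>"
  have "?sep" if "?low"
  proof -
    from that obtain \<eta> :: real where \<eta>: "\<And>t. t > 0 \<Longrightarrow> gen_entropy N g (x t) > ereal \<eta>"
      by blast
    obtain \<epsilon> where "\<epsilon> > 0" and "\<And>(y :: nat \<Rightarrow> real ^ 'd) i j.
        \<lbrakk>gen_entropy N g y > ereal \<eta>; i \<in> {1..N}; j \<in> {1..N}; i \<noteq> j\<rbrakk> \<Longrightarrow> norm (y i - y j) > \<epsilon>"
      using norm_diff_gt_if_gen_entropy_gt[OF assms(1,7,8) L, of \<eta>] by metis
    with \<eta> show ?thesis by blast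
  qed
  moreover have "?low" if "?sep"
  proof -
    from that obtain \<epsilon> where "\<epsilon> > 0" and \<epsilon>: "\<And>t i j.
        \<lbrakk>t > 0; i \<in> {1..N}; j \<in> {1..N}; i \<noteq> j\<rbrakk> \<Longrightarrow> norm (x t i - x t j) > \<epsilon>"
      by blast
    obtain \<eta> :: real where "\<And>y :: nat \<Rightarrow> real ^ 'd.
        (\<And>i j. \<lbrakk>i \<in> {1..N}; j \<in> {1..N}; i \<noteq> j\<rbrakk> \<Longrightarrow> norm (y i - y j) > \<epsilon>)
          \<Longrightarrow> gen_entropy N g y > ereal \<eta>"
      using gen_entropy_gt_if_norm_diff_gt[OF assms(1,7) \<open>\<epsilon> > 0\<close>] by blast
    with \<epsilon> show ?thesis by blast
  qed
  moreover have "declustered_on N {0..} x" if "?sep"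
    using that declustered_on_atLeast_0[OF assms(5)] by blast
  ultimately show ?thesis by blast
qed

end
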